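(* Let $G$ be a group with identity $e$, $H$ a subgroup of $G$, and $S$ a right transversal to $H$ in $G$ with $e\in S$. Let $\circ,\theta,\sigma,f$ be the associated operation, action and maps, and for $x\in S$, $a\in H$, $r\in\mathbb{N}=\{1,2,\dots\}$ let $\beta^r(x,a)\in S$ and $g^r(x,a)\in H$ be the recursively defined elements given in the context. Let $x\in S\setminus\{e\}$, $a\in H\setminus\{e\}$ and $m,n\in\mathbb{N}$. Then $(ax)^r=g^r(x,a)\,\beta^r(x,a)$ for every $r\in\mathbb{N}$, and the two keys $$K_A=\big(\beta^n(x,a)\,\theta\, g^m(x,a)\big)\circ\beta^m(x,a),\qquad K_B=\big(\beta^m(x,a)\,\theta\, g^n(x,a)\big)\circ\beta^n(x,a)$$ (the first computed from the pair $(g^m(x,a),\beta^m(x,a))$ and the received element $\beta^n(x,a)$, the second from the pair $(g^n(x,a),\beta^n(x,a))$ and the received element $\beta^m(x,a)$) coincide: $K_A=K_B=\beta^{m+n}(x,a)$.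
   Context: A right transversal to $H$ in $G$ is a subset $S\subseteq G$ containing exactly one element of each right coset $Hg$, and containing the identity $e$ of $G$. Every $g\in G$ is then uniquely $g=hx$ with $h\in H$ (the subgroup component) and $x\in S$ (the representative). For $x,y\in S$ and $h\in H$, the elements $f(x,y)\in H$, $x\circ y\in S$, $\sigma_x(h)\in H$, $x\theta h\in S$ are defined by the unique decompositions in $G$ $$xy=f(x,y)\,(x\circ y),\qquad xh=\sigma_x(h)\,(x\theta h).$$ The map $\theta$ is a right action of $H$ on $S$. For $x\in S$, $a\in H$ define recursively $\beta^1(x,a)=x$, $\beta^{r+1}(x,a)=(\beta^r(x,a)\theta a)\circ x$, and $g^1(x,a)=a$, $g^{r+1}(x,a)=g^r(x,a)\,\sigma_{\beta^r(x,a)}(a)\,f(\beta^r(x,a)\theta a,\,x)$. *)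

theory Defs
  imports "HOL-Algebra.Coset"
begin

definition right_transversal :: "('a, 'b) monoid_scheme \<Rightarrow> 'a set \<Rightarrow> 'a set \<Rightarrow> bool" where
  "right_transversal G H S \<longleftrightarrow>
     S \<subseteq> carrier G \<and> \<one>\<^bsub>G\<^esub> \<in> S \<and> (\<forall>C \<in> rcosets\<^bsub>G\<^esub> H. \<exists>!s. s \<in> S \<and> s \<in> C)"

definition sub_comp :: "('a, 'b) monoid_scheme \<Rightarrow> 'a set \<Rightarrow> 'a set \<Rightarrow> 'a \<Rightarrow> 'a" where
  "sub_comp G H S g = (THE h. h \<in> H \<and> (\<exists>s\<in>S. g = h \<otimes>\<^bsub>G\<^esub> s))"

definition rep_comp :: "('a, 'b) monoid_scheme \<Rightarrow> 'a set \<Rightarrow> 'a set \<Rightarrow> 'a \<Rightarrow> 'a" where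
  "rep_comp G H S g = (THE s. s \<in> S \<and> (\<exists>h\<in>H. g = h \<otimes>\<^bsub>G\<^esub> s))"

text \<open>The associated data, read off from the decompositions
  \<open>x y = f(x,y) (x \<circ> y)\<close> and \<open>x h = \<sigma>\<^sub>x(h) (x \<theta> h)\<close>; all are meant for
  \<open>x, y \<in> S\<close> and \<open>h \<in> H\<close>.\<close>

definition tr_f :: "('a, 'b) monoid_scheme \<Rightarrow> 'a set \<Rightarrow> 'a set \<Rightarrow> 'a \<Rightarrow> 'a \<Rightarrow> 'a" where
  "tr_f G H S x y = sub_comp G H S (x \<otimes>\<^bsub>G\<^esub> y)"

definition tr_op :: "('a, 'b) monoid_scheme \<Rightarrow> 'a set \<Rightarrow> 'a set \<Rightarrow> 'a \<Rightarrow> 'a \<Rightarrow> 'a" where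
  "tr_op G H S x y = rep_comp G H S (x \<otimes>\<^bsub>G\<^esub> y)"

definition tr_sigma :: "('a, 'b) monoid_scheme \<Rightarrow> 'a set \<Rightarrow> 'a set \<Rightarrow> 'a \<Rightarrow> 'a \<Rightarrow> 'a" where
  "tr_sigma G H S x h = sub_comp G H S (x \<otimes>\<^bsub>G\<^esub> h)"

definition tr_theta :: "('a, 'b) monoid_scheme \<Rightarrow> 'a set \<Rightarrow> 'a set \<Rightarrow> 'a \<Rightarrow> 'a \<Rightarrow> 'a" where
  "tr_theta G H S x h = rep_comp G H S (x \<otimes>\<^bsub>G\<^esub> h)"

text \<open>The exponent \<open>r\<close> starts at 1; the value at 0 is deliberately unspecified.\<close>

fun tr_beta :: "('a, 'b) monoid_scheme \<Rightarrow> 'a set \<Rightarrow> 'a set \<Rightarrow> nat \<Rightarrow> 'a \<Rightarrow> 'a \<Rightarrow> 'a" where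
  "tr_beta G H S 0 x a = undefined"
| "tr_beta G H S (Suc 0) x a = x"
| "tr_beta G H S (Suc (Suc r)) x a =
     tr_op G H S (tr_theta G H S (tr_beta G H S (Suc r) x a) a) x"

fun tr_g :: "('a, 'b) monoid_scheme \<Rightarrow> 'a set \<Rightarrow> 'a set \<Rightarrow> nat \<Rightarrow> 'a \<Rightarrow> 'a \<Rightarrow> 'a" where
  "tr_g G H S 0 x a = undefined"
| "tr_g G H S (Suc 0) x a = a"
| "tr_g G H S (Suc (Suc r)) x a =
     tr_g G H S (Suc r) x a
       \<otimes>\<^bsub>G\<^esub> tr_sigma G H S (tr_beta G H S (Suc r) x a) a
       \<otimes>\<^bsub>G\<^esub> tr_f G H S (tr_theta G H S (tr_beta G H S (Suc r) x a) a) x"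

text \<open>The decomposition is unique, so the definite descriptions above denote what they should.\<close>

lemma transversal_decomp_ex:
  assumes "group G" "subgroup H G" "right_transversal G H S" "g \<in> carrier G"
  shows "\<exists>h\<in>H. \<exists>s\<in>S. g = h \<otimes>\<^bsub>G\<^esub> s"
proof -
  interpret group G by fact
  interpret H: subgroup H G by fact
  have "H #>\<^bsub>G\<^esub> g \<in> rcosets\<^bsub>G\<^esub> H" using assms(4) by (simp add: rcosetsI H.subset)
  then obtain s where s: "s \<in> S" "s \<in> H #>\<^bsub>G\<^esub> g"
    using assms(3) unfolding right_transversal_def by blast
  then obtain k where k: "k \<in> H" "s = k \<otimes>\<^bsub>G\<^esub> g" unfolding r_coset_def by blast
  then have "g = inv\<^bsub>G\<^esub> k \<otimes>\<^bsub>G\<^esub> s"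
    using assms(4) H.mem_carrier[OF k(1)] by (simp add: m_assoc[symmetric])
  then show ?thesis using k(1) s(1) by blast
qed

lemma transversal_decomp_unique:
  assumes "group G" "subgroup H G" "right_transversal G H S"
    and "h \<in> H" "h' \<in> H" "s \<in> S" "s' \<in> S" "h \<otimes>\<^bsub>G\<^esub> s = h' \<otimes>\<^bsub>G\<^esub> s'"
  shows "h = h' \<and> s = s'"
proof -
  interpret group G by fact
  interpret H: subgroup H G by fact
  have c: "s \<in> carrier G" "s' \<in> carrier G" "h \<in> carrier G" "h' \<in> carrier G"
    using assms H.mem_carrier unfolding right_transversal_def by auto
  have "s = inv\<^bsub>G\<^esub> h \<otimes>\<^bsub>G\<^esub> (h' \<otimes>\<^bsub>G\<^esub> s')"
    using assms(8) c by (metis inv_solve_left m_closed)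
  then have "s = (inv\<^bsub>G\<^esub> h \<otimes>\<^bsub>G\<^esub> h') \<otimes>\<^bsub>G\<^esub> s'" using c by (simp add: m_assoc)
  moreover have "inv\<^bsub>G\<^esub> h \<otimes>\<^bsub>G\<^esub> h' \<in> H" using assms(4,5) by simp
  ultimately have "s \<in> H #>\<^bsub>G\<^esub> s'" unfolding r_coset_def by blast
  moreover have "s' \<in> H #>\<^bsub>G\<^esub> s'" using c assms(2) by (simp add: rcos_self)
  moreover have "H #>\<^bsub>G\<^esub> s' \<in> rcosets\<^bsub>G\<^esub> H" using c by (simp add: rcosetsI H.subset)
  ultimately have "s = s'" using assms(3,6,7) unfolding right_transversal_def by blast
  then show ?thesis using assms(8) c by simp
qed

lemma transversal_comps:
  assumes "group G" "subgroup H G" "right_transversal G H S" "h \<in> H" "s \<in> S"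
  shows "sub_comp G H S (h \<otimes>\<^bsub>G\<^esub> s) = h" "rep_comp G H S (h \<otimes>\<^bsub>G\<^esub> s) = s"
  unfolding sub_comp_def rep_comp_def
  using assms transversal_decomp_unique[OF assms(1-3)] by (blast intro!: the_equality)+

end

(* Multiplying two decompositions (h s)(k t) gives the representative (s \<theta> k) \<circ> t, independently
   of h. Hence the recursions for g^r and \<beta>^r compute the components of (a x)^r, and both keys are
   the representative of (a x)^(m+n) = (a x)^n (a x)^m = (a x)^m (a x)^n. *)
theory Submission
  imports Defs
begin

text \<open>Existence of a decomposition supplies a witness, and uniqueness identifies it with the
  values of the definite descriptions; later proofs then never unfold \<open>THE\<close>.\<close>

lemma transversal_comps_mem:
  assumes "group G" "subgroup H G" "right_transversal G H S" "g \<in> carrier G"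
  shows "sub_comp G H S g \<in> H" "rep_comp G H S g \<in> S"
    "sub_comp G H S g \<otimes>\<^bsub>G\<^esub> rep_comp G H S g = g"
proof -
  obtain h s where hs: "h \<in> H" "s \<in> S" "g = h \<otimes>\<^bsub>G\<^esub> s"
    using transversal_decomp_ex[OF assms] by blast
  note comps = transversal_comps[OF assms(1-3) hs(1,2), folded hs(3)]
  show "sub_comp G H S g \<in> H" "rep_comp G H S g \<in> S"
    "sub_comp G H S g \<otimes>\<^bsub>G\<^esub> rep_comp G H S g = g"
    unfolding comps using hs by simp_all
qed

text \<open>Push \<open>k\<close> leftwards past \<open>s\<close> using \<sigma> and \<theta>, then
  split the remaining product of two representatives using \<open>tr_f\<close> and
  \<open>tr_op\<close>. The factor \<open>k \<otimes> t\<close> is left general so that it can be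
  \<open>a \<otimes> x\<close>, for the recursion, or a power of it, for the keys.\<close>

lemma tr_decomp_mult:
  fixes G (structure)
  assumes G: "group G" "subgroup H G" "right_transversal G H S"
    and mem: "h \<in> H" "s \<in> S" "k \<in> H" "t \<in> S"
  defines "h' \<equiv> h \<otimes> tr_sigma G H S s k \<otimes> tr_f G H S (tr_theta G H S s k) t"
    and "s' \<equiv> tr_op G H S (tr_theta G H S s k) t"
  shows "h' \<in> H" "s' \<in> S" "(h \<otimes> s) \<otimes> (k \<otimes> t) = h' \<otimes> s'"
proof -
  interpret group G by fact
  interpret H: subgroup H G by fact
  have S: "z \<in> carrier G" if "z \<in> S" for z
    using that G(3) unfolding right_transversal_def by auto
  note car = S[OF mem(2)] S[OF mem(4)] H.mem_carrier[OF mem(1)] H.mem_carrier[OF mem(3)]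
  have sk: "tr_sigma G H S s k \<in> H" "tr_theta G H S s k \<in> S"
      "tr_sigma G H S s k \<otimes> tr_theta G H S s k = s \<otimes> k"
    using transversal_comps_mem[OF G, of "s \<otimes> k"] car
    by (simp_all add: tr_sigma_def tr_theta_def)
  define u where "u = tr_theta G H S s k"
  have u: "u \<in> S" using sk(2) by (simp add: u_def)
  have ut: "tr_f G H S u t \<in> H" "tr_op G H S u t \<in> S"
      "tr_f G H S u t \<otimes> tr_op G H S u t = u \<otimes> t"
    using transversal_comps_mem[OF G, of "u \<otimes> t"] S[OF u] car
    by (simp_all add: tr_f_def tr_op_def)
  show "h' \<in> H" "s' \<in> S"
    using mem(1) sk(1) ut unfolding h'_def s'_def u_def by auto
  \<comment> \<open>Collapse from the decomposed side: first recombine \<open>u \<otimes> t\<close>,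
    then \<open>s \<otimes> k\<close>.\<close>
  have "h' \<otimes> s' = h \<otimes> tr_sigma G H S s k \<otimes> (tr_f G H S u t \<otimes> tr_op G H S u t)"
    unfolding h'_def s'_def u_def[symmetric]
    using car H.mem_carrier[OF sk(1)] H.mem_carrier[OF ut(1)] S[OF ut(2)] by (simp add: m_assoc)
  also have "\<dots> = h \<otimes> (tr_sigma G H S s k \<otimes> u) \<otimes> t"
    unfolding ut(3) using car H.mem_carrier[OF sk(1)] S[OF u] by (simp add: m_assoc)
  also have "\<dots> = (h \<otimes> s) \<otimes> (k \<otimes> t)"
    unfolding u_def sk(3) using car by (simp add: m_assoc)
  finally show "(h \<otimes> s) \<otimes> (k \<otimes> t) = h' \<otimes> s'" by simp
qed

text \<open>Induction from 1, since both recursions are unspecified at 0. Membership is carried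
  along because multiplying decompositions requires it.\<close>

lemma tr_power_decomp:
  fixes G (structure)
  assumes G: "group G" "subgroup H G" "right_transversal G H S"
    and mem: "x \<in> S" "a \<in> H" and "r \<ge> 1"
  shows "tr_g G H S r x a \<in> H \<and> tr_beta G H S r x a \<in> S
    \<and> (a \<otimes> x) [^] r = tr_g G H S r x a \<otimes> tr_beta G H S r x a"
  using \<open>r \<ge> 1\<close>
proof (induction r rule: dec_induct)
  case base
  interpret group G by fact
  interpret H: subgroup H G by fact
  have "x \<in> carrier G" using mem(1) G(3) unfolding right_transversal_def by auto
  then show ?case using mem H.mem_carrier[OF mem(2)] by simp
next
  case (step r)
  interpret group G by fact
  \<comment> \<open>The recursive clauses only apply to exponents of the form
    \<open>Suc (Suc q)\<close>.\<close>
  obtain q where r: "r = Suc q" using step.hyps by (cases r) auto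
  from step.IH have IH: "tr_g G H S r x a \<in> H" "tr_beta G H S r x a \<in> S"
    "(a \<otimes> x) [^] r = tr_g G H S r x a \<otimes> tr_beta G H S r x a" by blast+
  \<comment> \<open>With \<open>k = a\<close> and \<open>t = x\<close>, the product formula is
    literally these clauses.\<close>
  show ?case
    using tr_decomp_mult[OF G IH(1,2) mem(2,1)] IH(3) by (simp add: r)
qed

text \<open>Both sides are the representative of the same power of \<open>a \<otimes> x\<close>,
  split as the \<open>n\<close>-th power times the \<open>m\<close>-th. The left factor enters the
  key only through its representative, which is the received element.\<close>

lemma tr_beta_add:
  fixes G (structure)
  assumes G: "group G" "subgroup H G" "right_transversal G H S"
    and mem: "x \<in> S" "a \<in> H" and "m \<ge> 1" "n \<ge> 1"
  shows "tr_op G H S (tr_theta G H S (tr_beta G H S n x a) (tr_g G H S m x a)) (tr_beta G H S m x a)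
    = tr_beta G H S (n + m) x a"
proof -
  interpret group G by fact
  interpret H: subgroup H G by fact
  have ax: "a \<otimes> x \<in> carrier G"
    using mem G(3) H.mem_carrier unfolding right_transversal_def by auto
  have pow: "(a \<otimes> x) [^] (n + m) = (a \<otimes> x) [^] n \<otimes> (a \<otimes> x) [^] m"
    using ax by (simp add: nat_pow_mult)
  have nm: "n + m \<ge> 1" using \<open>n \<ge> 1\<close> by simp
  note Pm = tr_power_decomp[OF G mem \<open>m \<ge> 1\<close>]
    and Pn = tr_power_decomp[OF G mem \<open>n \<ge> 1\<close>]
    and Pnm = tr_power_decomp[OF G mem nm]
  note prod = tr_decomp_mult[OF G Pn[THEN conjunct1] Pn[THEN conjunct2, THEN conjunct1]
      Pm[THEN conjunct1] Pm[THEN conjunct2, THEN conjunct1]]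
  \<comment> \<open>One decomposition comes from the product, the other from the exponent
    \<open>n + m\<close>; uniqueness equates their representatives.\<close>
  show ?thesis
    using transversal_decomp_unique[OF G prod(1) _ prod(2)] prod(3) pow Pm Pn Pnm by metis
qed

theorem mainTheorem1:
  fixes G :: "('a, 'b) monoid_scheme" (structure)
    and H S :: "'a set" and x a :: 'a and m n :: nat
  assumes "group G" and "subgroup H G" and "right_transversal G H S"
    and "x \<in> S - {\<one>}" and "a \<in> H - {\<one>}"
    and "m \<ge> 1" and "n \<ge> 1"
  shows "(\<forall>r::nat. r \<ge> 1 \<longrightarrow> (a \<otimes> x) [^] r = tr_g G H S r x a \<otimes> tr_beta G H S r x a)
    \<and> tr_op G H S (tr_theta G H S (tr_beta G H S n x a) (tr_g G H S m x a)) (tr_beta G H S m x a)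
        = tr_beta G H S (m + n) x a
    \<and> tr_op G H S (tr_theta G H S (tr_beta G H S m x a) (tr_g G H S n x a)) (tr_beta G H S n x a)
        = tr_beta G H S (m + n) x a"
proof -
  have mem: "x \<in> S" "a \<in> H" using assms(4,5) by auto
  show ?thesis
    \<comment> \<open>The two keys are the same fact with \<open>m\<close> and \<open>n\<close>
      exchanged, so they agree by commutativity of addition of exponents.\<close>
    using tr_power_decomp[OF assms(1-3) mem] tr_beta_add[OF assms(1-3) mem assms(6,7)]
      tr_beta_add[OF assms(1-3) mem assms(7,6)] by (simp add: add.commute)
qed

end
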